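(* Let $b\ge 2$, $s\ge 2$, $u\ge 0$ and $m$ be integers, let $\boldsymbol{e}=(e_1,\ldots,e_s)\in\mathbb{N}^s$ with $e_1\le\cdots\le e_s$ and $m\ge u+e_s$, and let $\beta_1,\ldots,\beta_s$ be positive integers with $\beta_i\le\lfloor (m-u)/e_i\rfloor$ for $1\le i\le s$. Let $Z$ be a mixed ordered orthogonal array $\mathrm{OOA}(b^m,(\beta_1,\ldots,\beta_s),l_1^1\cdots l_s^1,m-u)$, $l_i=b^{e_i}$, obtained from a $(u,m,\boldsymbol{e},s)$-net in base $b$. For $1\le i\le s$ let $C_i$ be the collection of columns $\boldsymbol{z}_{i,1},\ldots,\boldsymbol{z}_{i,\beta_i}$ of $Z$. Let $\mathcal{D}$ be a set of $s$-tuples $D=(D_1,\ldots,D_s)$ of functions $D_i:C_i\to R(b^{e_i})$, $1\le i\le s$, such that $$ \mathrm{HEIGHT}\left((D_1^{(1)},\ldots,D_s^{(1)})-(D_1^{(2)},\ldots,D_s^{(2)})\right)\le m-u $$ for all $(D_1^{(1)},\ldots,D_s^{(1)}),(D_1^{(2)},\ldots,D_s^{(2)})\in\mathcal{D}$. Then $b^m\ge |\mathcal{D}|$.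
   Context: $\mathbb{N}$ denotes the set of positive integers, $\lambda_s$ the $s$-dimensional Lebesgue measure, and $R(l)=\{0,1,\ldots,l-1\}\subset\mathbb{Z}$ for every integer $l\ge 2$. Elementary interval: for integers $b\ge 2$, $s\ge 1$, an interval $J\subseteq[0,1)^s$ is an elementary interval in base $b$ if $J=\prod_{i=1}^s [a_ib^{-d_i},(a_i+1)b^{-d_i})$ with integers $d_i\ge 0$ and $0\le a_i<b^{d_i}$ for $1\le i\le s$. $(u,m,\boldsymbol{e},s)$-net: let $b\ge 2$, $s\ge 1$, $0\le u\le m$ be integers and $\boldsymbol{e}=(e_1,\ldots,e_s)\in\mathbb{N}^s$. A point set $\mathcal{P}$ of $b^m$ points in $[0,1)^s$ (an indexed family; points are counted with multiplicity) is a $(u,m,\boldsymbol{e},s)$-net in base $b$ if every elementary interval $J=\prod_{i=1}^s [a_ib^{-d_i},(a_i+1)b^{-d_i})$ in base $b$, with integers $d_i\ge 0$, $0\le a_i<b^{d_i}$ and $e_i\mid d_i$ for $1\le i\le s$ and with volume $\lambda_s(J)\ge b^{u-m}$, contains exactly $b^m\lambda_s(J)$ points of $\mathcal{P}$. Array obtained from a net: let $\mathcal{P}$ be a $(u,m,\boldsymbol{e},s)$-net in base $b$ with points $\boldsymbol{x}_n=(x_n^{(1)},\ldots,x_n^{(s)})\in[0,1)^s$, $1\le n\le b^m$, where $x_n^{(i)}=\sum_{l=1}^m x_{l,n}^{(i)}b^{-l}$ with all $x_{l,n}^{(i)}\in R(b)$. For $1\le n\le b^m$, $1\le i\le s$,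 $1\le\rho_i\le\beta_i$ put $$z_{i,\rho_i}(n):=b^{\rho_ie_i}\sum_{l=(\rho_i-1)e_i+1}^{\rho_ie_i}x_{l,n}^{(i)}b^{-l}\in R(b^{e_i}).$$ The $b^m\times(\beta_1+\cdots+\beta_s)$ array $Z=(z_{i,\rho_i}(n))$, with rows indexed by $n$ and columns $\boldsymbol{z}_{i,\rho_i}$ indexed by the pairs $(i,\rho_i)$, is called the mixed ordered orthogonal array $\mathrm{OOA}(b^m,(\beta_1,\ldots,\beta_s),l_1^1\cdots l_s^1,m-u)$, with $l_i=b^{e_i}$, obtained from the net. Columns are treated as labelled by their indices $(i,\rho_i)$, so a function on $C_i$ is a function of $\rho_i\in\{1,\ldots,\beta_i\}$. Difference: for functions $D_i^{(1)},D_i^{(2)}:C_i\to R(b^{e_i})$, the function $D_i^{(1)}-D_i^{(2)}:C_i\to R(b^{e_i})$ is defined by $(D_i^{(1)}-D_i^{(2)})(\boldsymbol{z}):=D_i^{(1)}(\boldsymbol{z})-D_i^{(2)}(\boldsymbol{z})\pmod{b^{e_i}}$ (the residue in $R(b^{e_i})$); differences of $s$-tuples are taken componentwise. Profile and height: for $D=(D_1,\ldots,D_s)$ with $D_i:C_i\to R(b^{e_i})$, $\mathrm{PROFILE}(D):=(d_1,\ldots,d_s)$, where $d_i=0$ if $D_i(\boldsymbol{z}_{i,\rho_i})=0$ for all $1\le\rho_i\le\beta_i$, and $d_i=\max\{\rho_i: D_i(\boldsymbol{z}_{i,\rho_i})\ne 0\}$ otherwise; and $\mathrm{HEIGHT}(D):=\sum_{i=1}^s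 d_ie_i$. *)

theory Defs
  imports "HOL-Analysis.Analysis"
begin

text \<open>
  Coordinates are indexed by \<open>{1..s}\<close> and points of a point set by \<open>{1..b ^ m}\<close>. Points of
  \<open>[0,1)\<^sup>s\<close> and tuples of length \<open>s\<close> are extensional functions on \<open>{1..s}\<close>, so that equality of
  functions is equality of tuples.
\<close>

definition R :: "nat \<Rightarrow> int set" where
  "R l = {0..<int l}"

definition leb :: "nat \<Rightarrow> (nat \<Rightarrow> real) measure" where
  "leb s = (\<Pi>\<^sub>M i\<in>{1..s}. lborel)"

definition elem_interval :: "nat \<Rightarrow> nat \<Rightarrow> (nat \<Rightarrow> nat) \<Rightarrow> (nat \<Rightarrow> nat) \<Rightarrow> (nat \<Rightarrow> real) set" where
  "elem_interval b s d a =
     (\<Pi>\<^sub>E i\<in>{1..s}. {real (a i) / real b ^ d i ..< (real (a i) + 1) / real b ^ d i})"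

text \<open>The point set is a family \<open>x\<close>, so the points in an interval are counted with multiplicity.\<close>

definition is_net ::
  "nat \<Rightarrow> nat \<Rightarrow> nat \<Rightarrow> (nat \<Rightarrow> nat) \<Rightarrow> nat \<Rightarrow> (nat \<Rightarrow> nat \<Rightarrow> real) \<Rightarrow> bool" where
  "is_net b u m e s x \<longleftrightarrow>
     2 \<le> b \<and> 1 \<le> s \<and> u \<le> m \<and> (\<forall>i\<in>{1..s}. 1 \<le> e i) \<and>
     (\<forall>n\<in>{1..b ^ m}. x n \<in> {1..s} \<rightarrow>\<^sub>E {0..<1}) \<and>
     (\<forall>d a. (\<forall>i\<in>{1..s}. a i < b ^ d i \<and> e i dvd d i) \<and>
            measure (leb s) (elem_interval b s d a) \<ge> real b powi (int u - int m) \<longrightarrow>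
        real (card {n\<in>{1..b ^ m}. x n \<in> elem_interval b s d a}) =
          real b ^ m * measure (leb s) (elem_interval b s d a))"

text \<open>
  \<open>Z n i \<rho>\<close> is the entry of the array in row \<open>n\<close> and column \<open>(i, \<rho>)\<close>; \<open>y n i l\<close> is the \<open>l\<close>-th
  base-\<open>b\<close> digit of the \<open>i\<close>-th coordinate of the \<open>n\<close>-th point.
\<close>

definition ooa_from_points ::
  "nat \<Rightarrow> nat \<Rightarrow> (nat \<Rightarrow> nat) \<Rightarrow> nat \<Rightarrow> (nat \<Rightarrow> nat) \<Rightarrow> (nat \<Rightarrow> nat \<Rightarrow> real) \<Rightarrow>
    (nat \<Rightarrow> nat \<Rightarrow> nat \<Rightarrow> int) \<Rightarrow> bool" where
  "ooa_from_points b m e s \<beta> x Z \<longleftrightarrow>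
     (\<exists>y :: nat \<Rightarrow> nat \<Rightarrow> nat \<Rightarrow> int. \<forall>n\<in>{1..b ^ m}. \<forall>i\<in>{1..s}.
        (\<forall>l\<in>{1..m}. y n i l \<in> R b) \<and>
        x n i = (\<Sum>l=1..m. real_of_int (y n i l) / real b ^ l) \<and>
        (\<forall>\<rho>\<in>{1..\<beta> i}. real_of_int (Z n i \<rho>) =
           real b ^ (\<rho> * e i) *
             (\<Sum>l=(\<rho> - 1) * e i + 1..\<rho> * e i. real_of_int (y n i l) / real b ^ l)))"

text \<open>
  A column carries its label \<open>(i, \<rho>)\<close>, so columns with different labels are different
  even if they have the same entries.
\<close>

type_synonym column = "(nat \<times> nat) \<times> (nat \<Rightarrow> int)"

definition col :: "nat \<Rightarrow> nat \<Rightarrow> (nat \<Rightarrow> nat \<Rightarrow> nat \<Rightarrow> int) \<Rightarrow> nat \<Rightarrow> nat \<Rightarrow> column" where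
  "col b m Z i \<rho> = ((i, \<rho>), \<lambda>n\<in>{1..b ^ m}. Z n i \<rho>)"

definition cols ::
  "nat \<Rightarrow> nat \<Rightarrow> (nat \<Rightarrow> nat) \<Rightarrow> (nat \<Rightarrow> nat \<Rightarrow> nat \<Rightarrow> int) \<Rightarrow> nat \<Rightarrow> column set" where
  "cols b m \<beta> Z i = col b m Z i ` {1..\<beta> i}"

definition col_tuples ::
  "nat \<Rightarrow> nat \<Rightarrow> (nat \<Rightarrow> nat) \<Rightarrow> nat \<Rightarrow> (nat \<Rightarrow> nat) \<Rightarrow> (nat \<Rightarrow> nat \<Rightarrow> nat \<Rightarrow> int) \<Rightarrow>
    (nat \<Rightarrow> column \<Rightarrow> int) set" where
  "col_tuples b m e s \<beta> Z = (\<Pi>\<^sub>E i\<in>{1..s}. cols b m \<beta> Z i \<rightarrow>\<^sub>E R (b ^ e i))"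

definition tuple_diff ::
  "nat \<Rightarrow> nat \<Rightarrow> (nat \<Rightarrow> nat) \<Rightarrow> nat \<Rightarrow> (nat \<Rightarrow> nat) \<Rightarrow> (nat \<Rightarrow> nat \<Rightarrow> nat \<Rightarrow> int) \<Rightarrow>
    (nat \<Rightarrow> column \<Rightarrow> int) \<Rightarrow> (nat \<Rightarrow> column \<Rightarrow> int) \<Rightarrow> nat \<Rightarrow> column \<Rightarrow> int" where
  "tuple_diff b m e s \<beta> Z D D' =
     (\<lambda>i\<in>{1..s}. \<lambda>z\<in>cols b m \<beta> Z i. (D i z - D' i z) mod int (b ^ e i))"

definition profile ::
  "nat \<Rightarrow> nat \<Rightarrow> (nat \<Rightarrow> nat) \<Rightarrow> (nat \<Rightarrow> nat \<Rightarrow> nat \<Rightarrow> int) \<Rightarrow>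
    (nat \<Rightarrow> column \<Rightarrow> int) \<Rightarrow> nat \<Rightarrow> nat" where
  "profile b m \<beta> Z D i =
     (if \<forall>\<rho>\<in>{1..\<beta> i}. D i (col b m Z i \<rho>) = 0 then 0
      else Max {\<rho>\<in>{1..\<beta> i}. D i (col b m Z i \<rho>) \<noteq> 0})"

definition height ::
  "nat \<Rightarrow> nat \<Rightarrow> (nat \<Rightarrow> nat) \<Rightarrow> nat \<Rightarrow> (nat \<Rightarrow> nat) \<Rightarrow> (nat \<Rightarrow> nat \<Rightarrow> nat \<Rightarrow> int) \<Rightarrow>
    (nat \<Rightarrow> column \<Rightarrow> int) \<Rightarrow> nat" where
  "height b m e s \<beta> Z D = (\<Sum>i=1..s. profile b m \<beta> Z D i * e i)"

end

theory Submission
  imports Defs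
begin

text \<open>
  The array is tested with characters. A tuple \<open>D\<close> determines the function
  \<open>n \<mapsto> \<Prod>\<^sub>i \<Prod>\<^sub>\<rho> exp (2 \<pi> \<i> D\<^sub>i(\<rho>) z\<^sub>i\<^sub>,\<^sub>\<rho>(n) / b ^ e\<^sub>i)\<close> on the \<open>b ^ m\<close> rows
  (\<open>row_char\<close>). The product of one such function with the conjugate of another is the function of
  the difference of the two tuples. If a nonzero difference has profile \<open>(d\<^sub>1, \<dots>, d\<^sub>s)\<close> and height
  at most \<open>m - u\<close>, its function only involves the first \<open>d\<^sub>i\<close> columns of each group, that is, the
  first \<open>d\<^sub>i e\<^sub>i\<close> digits of the \<open>i\<close>-th coordinate. The net property says that each combination of
  these leading digits occurs for the same number of points (\<open>net_equidistributed\<close>), so the sum over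
  the rows is a multiple of a product of complete character sums (\<open>sum_net_prod\<close>), and the factor of
  a group with \<open>d\<^sub>i > 0\<close> vanishes (\<open>sum_digit_char_eq_0\<close>).

  Distinct members of \<open>\<D>\<close> therefore give orthogonal functions of absolute value 1 on a set with
  \<open>b ^ m\<close> elements, and Bessel's inequality for the indicator function of a single row bounds their
  number by \<open>b ^ m\<close> (\<open>card_le_if_orthogonal_unimodular\<close>).
\<close>

section \<open>Orthogonal unimodular functions\<close>

text \<open>
  This is Bessel's inequality for the indicator of the point \<open>r\<close>, in a form that avoids linear
  algebra: for \<open>w = (\<Sum>D\<in>\<D>. cnj (\<phi> D r) * \<phi> D)\<close>, the value \<open>w r\<close> is \<open>card \<D>\<close>, while
  orthogonality gives \<open>\<parallel>w\<parallel>\<^sup>2 = card \<D> * card N\<close>; now compare \<open>\<bar>w r\<bar>\<^sup>2\<close> with \<open>\<parallel>w\<parallel>\<^sup>2\<close>. An infinite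
  \<open>\<D>\<close> has \<open>card \<D> = 0\<close> by convention.
\<close>

lemma card_le_if_orthogonal_unimodular:
  fixes \<phi> :: "'d \<Rightarrow> 'n \<Rightarrow> complex"
  assumes "finite N" "r \<in> N"
    and unimod: "\<And>D n. D \<in> \<D> \<Longrightarrow> n \<in> N \<Longrightarrow> norm (\<phi> D n) = 1"
    and orth: "\<And>D D'. D \<in> \<D> \<Longrightarrow> D' \<in> \<D> \<Longrightarrow> D \<noteq> D' \<Longrightarrow> (\<Sum>n\<in>N. \<phi> D n * cnj (\<phi> D' n)) = 0"
  shows "card \<D> \<le> card N"
proof (cases "finite \<D>")
  case True
  define w where "w n = (\<Sum>D\<in>\<D>. cnj (\<phi> D r) * \<phi> D n)" for n
  have unit: "\<phi> D n * cnj (\<phi> D n) = 1" if "D \<in> \<D>" "n \<in> N" for D n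
    using unimod[OF that] by (simp add: complex_norm_square[symmetric])
  have w0: "w r = of_nat (card \<D>)"
    unfolding w_def using unit assms(2) by (simp add: mult.commute)
  have gram: "(\<Sum>n\<in>N. \<phi> D n * cnj (\<phi> D' n)) = (if D = D' then of_nat (card N) else 0)"
    if "D \<in> \<D>" "D' \<in> \<D>" for D D'
    using orth[OF that] unit[OF that(1)] by (cases "D = D'") auto
  have "(\<Sum>n\<in>N. w n * cnj (w n)) =
      (\<Sum>n\<in>N. \<Sum>D\<in>\<D>. \<Sum>D'\<in>\<D>. (cnj (\<phi> D r) * \<phi> D' r) * (\<phi> D n * cnj (\<phi> D' n)))"
    unfolding w_def cnj_sum sum_product by (simp add: algebra_simps)
  also have "\<dots> = (\<Sum>D\<in>\<D>. \<Sum>D'\<in>\<D>. (cnj (\<phi> D r) * \<phi> D' r) * (\<Sum>n\<in>N. \<phi> D n * cnj (\<phi> D' n)))"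
    by (subst sum.swap, rule sum.cong[OF refl], subst sum.swap) (simp add: sum_distrib_left)
  also have "\<dots> = (\<Sum>D\<in>\<D>. \<Sum>D'\<in>\<D>. if D = D' then of_nat (card N) else 0)"
  proof (intro sum.cong refl)
    fix D D' assume *: "D \<in> \<D>" "D' \<in> \<D>"
    show "(cnj (\<phi> D r) * \<phi> D' r) * (\<Sum>n\<in>N. \<phi> D n * cnj (\<phi> D' n)) =
        (if D = D' then of_nat (card N) else 0)"
      using gram[OF *] unit[OF *(1) assms(2)] by (cases "D = D'") (auto simp: mult.commute)
  qed
  also have "\<dots> = of_nat (card \<D> * card N)"
    using True by simp
  finally have "complex_of_real (\<Sum>n\<in>N. (norm (w n))\<^sup>2) = complex_of_real (real (card \<D> * card N))"
    by (simp add: complex_norm_square del: of_real_power)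
  then have "(\<Sum>n\<in>N. (norm (w n))\<^sup>2) = real (card \<D> * card N)"
    using of_real_eq_iff by blast
  moreover have "(norm (w r))\<^sup>2 \<le> (\<Sum>n\<in>N. (norm (w n))\<^sup>2)"
    using assms(1,2) by (intro member_le_sum) auto
  ultimately have "(real (card \<D>))\<^sup>2 \<le> real (card \<D> * card N)"
    by (simp add: w0)
  then have "card \<D> * card \<D> \<le> card \<D> * card N"
    by (metis of_nat_le_iff of_nat_mult power2_eq_square)
  then show ?thesis
    by (cases "card \<D> = 0") auto
qed simp

section \<open>Additive characters modulo q\<close>

definition additive_char :: "nat \<Rightarrow> int \<Rightarrow> complex" where
  "additive_char q k = cis (2 * pi * real_of_int k / real q)"

lemma norm_additive_char [simp]: "norm (additive_char q k) = 1"
  by (simp add: additive_char_def)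

lemma additive_char_0 [simp]: "additive_char q 0 = 1"
  by (simp add: additive_char_def)

lemma additive_char_add: "additive_char q (j + k) = additive_char q j * additive_char q k"
  by (simp add: additive_char_def cis_mult ring_distribs add_divide_distrib)

lemma cnj_additive_char: "cnj (additive_char q k) = additive_char q (- k)"
  by (simp add: additive_char_def cis_cnj)

lemma additive_char_eq_1_iff:
  assumes "q > 0"
  shows "additive_char q k = 1 \<longleftrightarrow> int q dvd k"
proof -
  have "additive_char q k = 1 \<longleftrightarrow> (\<exists>j::int. 2 * pi * real_of_int k / real q = real_of_int j * 2 * pi)"
    unfolding additive_char_def complex_eq_iff
    using cos_one_2pi_int[of "2 * pi * real_of_int k / real q"]
      cos_one_sin_zero[of "2 * pi * real_of_int k / real q"] by auto
  also have "\<dots> \<longleftrightarrow> (\<exists>j::int. real_of_int k = real_of_int (j * int q))"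
    using assms by (simp add: field_simps)
  also have "\<dots> \<longleftrightarrow> int q dvd k"
    by (metis dvd_def mult.commute of_int_eq_iff)
  finally show ?thesis .
qed

lemma additive_char_cong:
  assumes "q > 0" "j mod int q = k mod int q"
  shows "additive_char q j = additive_char q k"
proof -
  have "additive_char q (j - k) = 1"
    using assms by (simp add: additive_char_eq_1_iff mod_eq_dvd_iff)
  then show ?thesis
    using additive_char_add[of q "j - k" k] by simp
qed

lemma additive_char_power: "additive_char q k ^ c = additive_char q (k * int c)"
  by (induction c) (simp_all add: additive_char_add[symmetric] algebra_simps)

lemma sum_additive_char_eq_0:
  assumes "q > 0" "\<not> int q dvd k"
  shows "(\<Sum>c<q. additive_char q (k * int c)) = 0"
proof -
  have "additive_char q k \<noteq> 1"
    using assms by (simp add: additive_char_eq_1_iff)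
  moreover have "additive_char q k ^ q = 1"
    using assms by (simp add: additive_char_power additive_char_eq_1_iff)
  ultimately show ?thesis
    by (simp add: additive_char_power[symmetric] geometric_sum)
qed

text \<open>
  Here \<open>a\<close> runs through all words of \<open>d\<close> base-\<open>q\<close> digits, the \<open>\<rho>\<close>-th digit counted from the most
  significant one being \<open>a div q ^ (d - \<rho>) mod q\<close>. Only the least significant digit meets the
  nonzero frequency \<open>k d\<close>, so summing over that digit first already gives 0.
\<close>

lemma sum_digit_char_eq_0:
  fixes k :: "nat \<Rightarrow> int"
  assumes "q > 0" "d > 0" "\<not> int q dvd k d"
  shows "(\<Sum>a<q ^ d. \<Prod>\<rho>=1..d. additive_char q (k \<rho> * int (a div q ^ (d - \<rho>) mod q))) = 0"
proof -
  obtain d' where d: "d = Suc d'"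
    using assms(2) gr0_conv_Suc by blast
  define G where
    "G a = (\<Prod>\<rho>=1..d. additive_char q (k \<rho> * int (a div q ^ (d - \<rho>) mod q)))" for a
  define H where
    "H a = (\<Prod>\<rho>=1..d'. additive_char q (k \<rho> * int (a div q ^ (d' - \<rho>) mod q)))" for a
  have split: "G (c + a * q) = H a * additive_char q (k d * int c)" if "c < q" for a c
  proof -
    have "(c + a * q) div q ^ (d - \<rho>) = a div q ^ (d' - \<rho>)" if "\<rho> \<in> {1..d'}" for \<rho>
    proof -
      have "q ^ (d - \<rho>) = q * q ^ (d' - \<rho>)"
        using that by (simp add: d Suc_diff_le)
      then show ?thesis
        using \<open>c < q\<close> assms(1) by (simp add: div_mult2_eq)
    qed
    then have "(\<Prod>\<rho>=1..d'. additive_char q (k \<rho> * int ((c + a * q) div q ^ (d - \<rho>) mod q))) = H a"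
      unfolding H_def by (intro prod.cong) auto
    then show ?thesis
      using that by (simp add: G_def d)
  qed
  have "(\<Sum>a<q ^ d. G a) = (\<Sum>a<q ^ d'. sum G {a * q..<a * q + q})"
    by (simp add: sum.nat_group d mult.commute)
  also have "\<dots> = (\<Sum>a<q ^ d'. \<Sum>c<q. G (c + a * q))"
  proof (rule sum.cong[OF refl])
    show "sum G {a * q..<a * q + q} = (\<Sum>c<q. G (c + a * q))" for a
      using sum.shift_bounds_nat_ivl[of G 0 "a * q" q] by (simp add: atLeast0LessThan add.commute)
  qed
  also have "\<dots> = (\<Sum>a<q ^ d'. H a * (\<Sum>c<q. additive_char q (k d * int c)))"
    by (simp add: split sum_distrib_left)
  also have "\<dots> = 0"
    using sum_additive_char_eq_0[OF assms(1,3)] by simp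
  finally show ?thesis
    by (simp add: G_def)
qed

section \<open>Digit blocks\<close>

text \<open>
  The upper bound is strict because the expansion is finite: the segment is at most the geometric
  sum \<open>1 / b ^ k - 1 / b ^ M\<close>. Strictness ensures that the given digits are the ones found by the
  floor function.
\<close>

lemma digit_segment_bounds:
  fixes y :: "nat \<Rightarrow> int"
  assumes "b \<ge> 2" "k \<le> M" "\<forall>l\<in>{k+1..M}. y l \<in> R b"
  shows "0 \<le> (\<Sum>l=k+1..M. real_of_int (y l) / real b ^ l)"
    and "(\<Sum>l=k+1..M. real_of_int (y l) / real b ^ l) < 1 / real b ^ k"
proof -
  show "0 \<le> (\<Sum>l=k+1..M. real_of_int (y l) / real b ^ l)"
    using assms(3) by (intro sum_nonneg) (auto simp: R_def)
  have "(\<Sum>l=k+1..M. real_of_int (y l) / real b ^ l) \<le> 1 / real b ^ k - 1 / real b ^ M"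
    using assms(2,3)
  proof (induction M rule: dec_induct)
    case (step M)
    have "y (Suc M) \<le> int b - 1"
      using step by (auto simp: R_def)
    then have "real_of_int (y (Suc M)) \<le> real b - 1"
      by linarith
    then have "real_of_int (y (Suc M)) / real b ^ Suc M \<le> (real b - 1) / real b ^ Suc M"
      by (intro divide_right_mono) auto
    also have "\<dots> = 1 / real b ^ M - 1 / real b ^ Suc M"
      using assms(1) by (simp add: field_simps)
    finally show ?case
      using step by simp
  qed simp
  moreover have "1 / real b ^ M > 0"
    using assms(1) by simp
  ultimately show "(\<Sum>l=k+1..M. real_of_int (y l) / real b ^ l) < 1 / real b ^ k"
    by linarith
qed

text \<open>
  An entry of the array is defined from a digit expansion, whereas elementary intervals see the real
  number. The link: multiplying \<open>t\<close> by \<open>b ^ (\<rho> * e)\<close> gives a multiple of \<open>b ^ e\<close> from the digits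
  before the block, the number \<open>z < b ^ e\<close> formed by the block, and a remainder in \<open>[0,1)\<close>.
\<close>

lemma digit_block_eq_floor_mod:
  fixes y :: "nat \<Rightarrow> int"
  assumes b: "b \<ge> 2" and y: "\<forall>l\<in>{1..m}. y l \<in> R b"
    and t: "t = (\<Sum>l=1..m. real_of_int (y l) / real b ^ l)"
    and \<rho>: "1 \<le> \<rho>" "\<rho> * e \<le> m"
    and z: "real_of_int z =
      real b ^ (\<rho> * e) * (\<Sum>l=(\<rho> - 1) * e + 1..\<rho> * e. real_of_int (y l) / real b ^ l)"
  shows "z = \<lfloor>real b ^ (\<rho> * e) * t\<rfloor> mod int (b ^ e)"
proof -
  define j where "j = (\<rho> - 1) * e"
  define P where "P = (\<Sum>l=1..j. y l * int b ^ (j - l))"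
  define T where "T = (\<Sum>l=\<rho> * e + 1..m. real_of_int (y l) / real b ^ l)"
  have j: "\<rho> * e = j + e"
    using \<rho>(1) by (cases \<rho>) (auto simp: j_def)
  have bpos: "real b > 0"
    using b by simp
  have "real b ^ j * (\<Sum>l=1..j. real_of_int (y l) / real b ^ l) = real_of_int P"
    unfolding P_def sum_distrib_left of_int_sum
  proof (intro sum.cong refl)
    fix l assume "l \<in> {1..j}"
    then have "real b ^ j = real b ^ (j - l) * real b ^ l"
      by (simp add: power_add[symmetric])
    then show "real b ^ j * (real_of_int (y l) / real b ^ l) = real_of_int (y l * int b ^ (j - l))"
      using bpos by simp
  qed
  then have "real b ^ (\<rho> * e) * (\<Sum>l=1..j. real_of_int (y l) / real b ^ l) =
      real_of_int (P * int (b ^ e))"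
    by (simp add: j power_add mult_ac)
  moreover have "t = (\<Sum>l=1..j. real_of_int (y l) / real b ^ l)
      + (\<Sum>l=j + 1..\<rho> * e. real_of_int (y l) / real b ^ l) + T"
    using \<rho>(2) j sum.ub_add_nat[of 1 j "\<lambda>l. real_of_int (y l) / real b ^ l" e]
      sum.ub_add_nat[of 1 "\<rho> * e" "\<lambda>l. real_of_int (y l) / real b ^ l" "m - \<rho> * e"]
    by (simp add: t T_def)
  ultimately have split: "real b ^ (\<rho> * e) * t =
      real_of_int (P * int (b ^ e) + z) + real b ^ (\<rho> * e) * T"
    using z by (simp add: j_def algebra_simps)
  have "0 \<le> T" "T < 1 / real b ^ (\<rho> * e)"
    unfolding T_def using b y \<rho> by (intro digit_segment_bounds; auto)+
  then have "0 \<le> real b ^ (\<rho> * e) * T" "real b ^ (\<rho> * e) * T < 1"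
    using bpos by (simp_all add: field_simps)
  then have floor: "\<lfloor>real b ^ (\<rho> * e) * t\<rfloor> = P * int (b ^ e) + z"
    unfolding split by (intro floor_unique) auto
  have seg: "0 \<le> (\<Sum>l=j + 1..\<rho> * e. real_of_int (y l) / real b ^ l)"
    "(\<Sum>l=j + 1..\<rho> * e. real_of_int (y l) / real b ^ l) < 1 / real b ^ j"
    using b y \<rho> j by (intro digit_segment_bounds; auto)+
  have "0 \<le> real_of_int z"
    using seg(1) by (simp add: z j_def)
  moreover have "real_of_int z < real (b ^ e)"
  proof -
    have "real_of_int z < real b ^ (\<rho> * e) * (1 / real b ^ j)"
      using seg(2) bpos unfolding z j_def[symmetric] by (intro mult_strict_left_mono) auto
    also have "\<dots> = real (b ^ e)"
      using bpos by (simp add: j power_add)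
    finally show ?thesis .
  qed
  ultimately have "0 \<le> z" "z < int (b ^ e)"
    by linarith+
  then show ?thesis
    by (simp add: floor)
qed

text \<open>
  All the blocks up to the \<open>d\<close>-th can be read off from the single integer \<open>\<lfloor>q ^ d * t\<rfloor>\<close>.
\<close>

lemma floor_div_power:
  fixes t :: real
  assumes "q > 0" "\<rho> \<le> d" "t \<ge> 0"
  shows "\<lfloor>real q ^ \<rho> * t\<rfloor> = int (nat \<lfloor>real q ^ d * t\<rfloor> div q ^ (d - \<rho>))"
proof -
  have "real q ^ d = real q ^ \<rho> * real q ^ (d - \<rho>)"
    using assms(2) by (simp add: power_add[symmetric])
  then have "real q ^ \<rho> * t = (real q ^ d * t) / real_of_int (int (q ^ (d - \<rho>)))"
    using assms(1) by simp
  then have "\<lfloor>real q ^ \<rho> * t\<rfloor> = \<lfloor>real q ^ d * t\<rfloor> div int (q ^ (d - \<rho>))"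
    using floor_divide_real_eq_div[of "int (q ^ (d - \<rho>))" "real q ^ d * t"] by simp
  then show ?thesis
    using assms by (simp add: zdiv_int)
qed

section \<open>Equidistribution of the leading digits of a net\<close>

lemma measure_elem_interval:
  assumes "b > 0"
  shows "measure (leb s) (elem_interval b s d a) = 1 / real b ^ (\<Sum>i=1..s. d i)"
proof -
  interpret finite_product_sigma_finite "\<lambda>_. lborel :: real measure" "{1..s}"
    by standard auto
  have "emeasure (leb s) (elem_interval b s d a) =
      (\<Prod>i=1..s. emeasure lborel {real (a i) / real b ^ d i ..< (real (a i) + 1) / real b ^ d i})"
    unfolding leb_def elem_interval_def by (intro measure_times) auto
  also have "\<dots> = (\<Prod>i=1..s. ennreal (1 / real b ^ d i))"
    using assms by (intro prod.cong refl) (simp add: field_simps emeasure_lborel_Ico divide_right_mono)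
  also have "\<dots> = ennreal (\<Prod>i=1..s. 1 / real b ^ d i)"
    by (intro prod_ennreal) auto
  also have "(\<Prod>i=1..s. 1 / real b ^ d i) = 1 / real b ^ (\<Sum>i=1..s. d i)"
    by (simp add: prod_dividef power_sum)
  finally show ?thesis
    by (simp add: measure_def)
qed

text \<open>
  The \<open>i\<close>-th component encodes the first \<open>d i * e i\<close> digits of the \<open>i\<close>-th coordinate as one number.
  The function is extensional, so that the possible values form a \<open>PiE\<close> box.
\<close>

definition leading_block :: "nat \<Rightarrow> (nat \<Rightarrow> nat) \<Rightarrow> nat \<Rightarrow> (nat \<Rightarrow> nat) \<Rightarrow> (nat \<Rightarrow> real) \<Rightarrow> nat \<Rightarrow> nat" where
  "leading_block b e s d p = (\<lambda>i\<in>{1..s}. nat \<lfloor>real (b ^ e i) ^ d i * p i\<rfloor>)"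

text \<open>
  The points with given leading digits are those in the elementary interval with exponents
  \<open>d i * e i\<close>. These are divisible by \<open>e i\<close>, and the bound on their sum makes the volume large
  enough for the net property to apply.
\<close>

lemma net_equidistributed:
  assumes net: "is_net b u m e s x"
    and sum: "(\<Sum>i=1..s. d i * e i) \<le> m - u"
    and a: "a \<in> (\<Pi>\<^sub>E i\<in>{1..s}. {..<(b ^ e i) ^ d i})"
  shows "card {n\<in>{1..b ^ m}. leading_block b e s d (x n) = a} = b ^ (m - (\<Sum>i=1..s. d i * e i))"
proof -
  let ?d = "\<lambda>i. d i * e i" and ?S = "\<Sum>i=1..s. d i * e i"
  have b: "b \<ge> 2" and u: "u \<le> m" and x: "\<And>n. n \<in> {1..b ^ m} \<Longrightarrow> x n \<in> {1..s} \<rightarrow>\<^sub>E {0..<1}"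
    using net by (auto simp: is_net_def)
  have bpos: "real b > 0"
    using b by simp
  have mem: "x n \<in> elem_interval b s ?d a \<longleftrightarrow> leading_block b e s d (x n) = a"
    if "n \<in> {1..b ^ m}" for n
  proof -
    have *: "(real (a i) / real b ^ ?d i \<le> x n i \<and> x n i < (real (a i) + 1) / real b ^ ?d i)
        \<longleftrightarrow> nat \<lfloor>real (b ^ e i) ^ d i * x n i\<rfloor> = a i" if "i \<in> {1..s}" for i
    proof -
      have "0 \<le> real b ^ ?d i * x n i"
        using x[OF \<open>n \<in> _\<close>] that bpos by (auto simp: PiE_iff)
      then have "nat \<lfloor>real b ^ ?d i * x n i\<rfloor> = a i \<longleftrightarrow> \<lfloor>real b ^ ?d i * x n i\<rfloor> = int (a i)"
        by (simp add: nat_eq_iff)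
      also have "\<dots> \<longleftrightarrow> real (a i) \<le> real b ^ ?d i * x n i \<and> real b ^ ?d i * x n i < real (a i) + 1"
        by (simp add: floor_eq_iff)
      also have "\<dots> \<longleftrightarrow> real (a i) / real b ^ ?d i \<le> x n i \<and> x n i < (real (a i) + 1) / real b ^ ?d i"
        using bpos by (simp add: field_simps)
      finally show ?thesis
        by (simp add: power_mult[symmetric] mult.commute)
    qed
    have "x n \<in> elem_interval b s ?d a \<longleftrightarrow>
        (\<forall>i\<in>{1..s}. nat \<lfloor>real (b ^ e i) ^ d i * x n i\<rfloor> = a i)"
      using x[OF that] * by (auto simp: elem_interval_def PiE_iff)
    also have "\<dots> \<longleftrightarrow> leading_block b e s d (x n) = a"
      using a by (auto simp: leading_block_def PiE_iff fun_eq_iff extensional_def restrict_def)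
    finally show ?thesis .
  qed
  have vol: "measure (leb s) (elem_interval b s ?d a) = 1 / real b ^ ?S"
    using b by (intro measure_elem_interval) auto
  have "real b powi (int u - int m) = 1 / real b ^ (m - u)"
    using u bpos by (simp add: power_int_def nat_diff_distrib' power_one_over inverse_eq_divide)
  also have "\<dots> \<le> 1 / real b ^ ?S"
    using sum b by (intro divide_left_mono power_increasing) auto
  finally have "real (card {n\<in>{1..b ^ m}. x n \<in> elem_interval b s ?d a}) = real b ^ m * (1 / real b ^ ?S)"
    using net a unfolding is_net_def vol[symmetric]
    by (auto simp: PiE_iff power_mult[symmetric] mult.commute)
  also have "\<dots> = real (b ^ (m - ?S))"
  proof -
    have "m = (m - ?S) + ?S"
      using sum by linarith
    then have "real b ^ m = real b ^ (m - ?S) * real b ^ ?S"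
      by (metis power_add)
    then show ?thesis
      using bpos by simp
  qed
  finally have "card {n\<in>{1..b ^ m}. x n \<in> elem_interval b s ?d a} = b ^ (m - ?S)"
    using of_nat_eq_iff by blast
  moreover have "{n\<in>{1..b ^ m}. x n \<in> elem_interval b s ?d a} =
      {n\<in>{1..b ^ m}. leading_block b e s d (x n) = a}"
    using mem by blast
  ultimately show ?thesis
    by simp
qed

text \<open>
  Grouping the points by their leading digits turns a sum over the net into a sum over a box, where a
  product of functions of the separate coordinates factors.
\<close>

lemma sum_net_prod:
  fixes f :: "nat \<Rightarrow> nat \<Rightarrow> 'c::comm_semiring_1"
  assumes net: "is_net b u m e s x" and sum: "(\<Sum>i=1..s. d i * e i) \<le> m - u"
  shows "(\<Sum>n\<in>{1..b ^ m}. \<Prod>i=1..s. f i (nat \<lfloor>real (b ^ e i) ^ d i * x n i\<rfloor>)) =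
    of_nat (b ^ (m - (\<Sum>i=1..s. d i * e i))) * (\<Prod>i=1..s. \<Sum>a<(b ^ e i) ^ d i. f i a)"
proof -
  let ?B = "\<Pi>\<^sub>E i\<in>{1..s}. {..<(b ^ e i) ^ d i}" and ?L = "\<lambda>n. leading_block b e s d (x n)"
  have b: "b \<ge> 2" and x: "\<And>n. n \<in> {1..b ^ m} \<Longrightarrow> x n \<in> {1..s} \<rightarrow>\<^sub>E {0..<1}"
    using net by (auto simp: is_net_def)
  have range: "?L n \<in> ?B" if "n \<in> {1..b ^ m}" for n
  proof -
    have "nat \<lfloor>real (b ^ e i) ^ d i * x n i\<rfloor> < (b ^ e i) ^ d i" if "i \<in> {1..s}" for i
    proof -
      have "0 \<le> x n i" "x n i < 1"
        using x[OF \<open>n \<in> _\<close>] that by (auto simp: PiE_iff)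
      then have "real (b ^ e i) ^ d i * x n i < real ((b ^ e i) ^ d i)" "0 \<le> real (b ^ e i) ^ d i * x n i"
        using b by auto
      then show ?thesis
        by linarith
    qed
    then show ?thesis
      by (auto simp: leading_block_def)
  qed
  have "(\<Sum>n\<in>{1..b ^ m}. \<Prod>i=1..s. f i (nat \<lfloor>real (b ^ e i) ^ d i * x n i\<rfloor>)) =
      (\<Sum>n\<in>{1..b ^ m}. \<Prod>i=1..s. f i (?L n i))"
    by (simp add: leading_block_def)
  also have "\<dots> = (\<Sum>a\<in>?B. \<Sum>n\<in>{n\<in>{1..b ^ m}. ?L n = a}. \<Prod>i=1..s. f i (?L n i))"
    using range by (intro sum.group[symmetric] finite_PiE) blast+
  also have "\<dots> = (\<Sum>a\<in>?B. of_nat (b ^ (m - (\<Sum>i=1..s. d i * e i))) * (\<Prod>i=1..s. f i (a i)))"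
  proof (intro sum.cong refl)
    fix a assume "a \<in> ?B"
    have "(\<Sum>n\<in>{n\<in>{1..b ^ m}. ?L n = a}. \<Prod>i=1..s. f i (?L n i)) =
        (\<Sum>n\<in>{n\<in>{1..b ^ m}. ?L n = a}. \<Prod>i=1..s. f i (a i))"
      by (intro sum.cong) auto
    then show "(\<Sum>n\<in>{n\<in>{1..b ^ m}. ?L n = a}. \<Prod>i=1..s. f i (?L n i)) =
        of_nat (b ^ (m - (\<Sum>i=1..s. d i * e i))) * (\<Prod>i=1..s. f i (a i))"
      by (simp only: sum_constant net_equidistributed[OF net sum \<open>a \<in> ?B\<close>])
  qed
  also have "\<dots> = of_nat (b ^ (m - (\<Sum>i=1..s. d i * e i))) * (\<Prod>i=1..s. \<Sum>a<(b ^ e i) ^ d i. f i a)"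
    by (subst prod_sum_PiE) (auto simp: sum_distrib_left)
  finally show ?thesis .
qed

section \<open>Characters on the rows of the array\<close>

definition row_char ::
  "nat \<Rightarrow> (nat \<Rightarrow> nat) \<Rightarrow> nat \<Rightarrow> (nat \<Rightarrow> nat) \<Rightarrow> (nat \<Rightarrow> nat \<Rightarrow> nat \<Rightarrow> int) \<Rightarrow>
    (nat \<Rightarrow> nat \<Rightarrow> int) \<Rightarrow> nat \<Rightarrow> complex" where
  "row_char b e s \<beta> Z k n = (\<Prod>i=1..s. \<Prod>\<rho>=1..\<beta> i. additive_char (b ^ e i) (k i \<rho> * Z n i \<rho>))"

lemma norm_row_char [simp]: "norm (row_char b e s \<beta> Z k n) = 1"
  by (simp add: row_char_def prod_norm[symmetric])

text \<open>
  Reducing the frequencies modulo \<open>b ^ e i\<close> does not change the characters, which is why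
  \<open>tuple_diff\<close> may take residues.
\<close>

lemma row_char_diff:
  assumes "b > 0"
    and "\<And>i \<rho>. i \<in> {1..s} \<Longrightarrow> \<rho> \<in> {1..\<beta> i} \<Longrightarrow> h i \<rho> = (k i \<rho> - k' i \<rho>) mod int (b ^ e i)"
  shows "row_char b e s \<beta> Z k n * cnj (row_char b e s \<beta> Z k' n) = row_char b e s \<beta> Z h n"
proof -
  have "additive_char (b ^ e i) (k i \<rho> * Z n i \<rho>) * cnj (additive_char (b ^ e i) (k' i \<rho> * Z n i \<rho>)) =
      additive_char (b ^ e i) (h i \<rho> * Z n i \<rho>)" if "i \<in> {1..s}" "\<rho> \<in> {1..\<beta> i}" for i \<rho>
  proof -
    have "additive_char (b ^ e i) ((k i \<rho> - k' i \<rho>) * Z n i \<rho>) = additive_char (b ^ e i) (h i \<rho> * Z n i \<rho>)"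
      using assms(1) unfolding assms(2)[OF that]
      by (intro additive_char_cong) (auto simp: mod_mult_left_eq)
    then show ?thesis
      by (simp add: cnj_additive_char additive_char_add[symmetric] algebra_simps)
  qed
  then show ?thesis
    by (simp add: row_char_def cnj_prod prod.distrib[symmetric])
qed

text \<open>
  The frequencies vanish beyond \<open>d\<close>, so the character only depends on the leading digits selected by
  \<open>d\<close>. Its sum is then a product over the coordinates, and the factor of \<open>j\<close> is zero.
\<close>

lemma sum_row_char_eq_0:
  assumes net: "is_net b u m e s x" and ooa: "ooa_from_points b m e s \<beta> x Z"
    and \<beta>: "\<And>i. i \<in> {1..s} \<Longrightarrow> \<beta> i * e i \<le> m"
    and d: "\<And>i. i \<in> {1..s} \<Longrightarrow> d i \<le> \<beta> i"
    and vanish: "\<And>i \<rho>. i \<in> {1..s} \<Longrightarrow> \<rho> \<in> {d i<..\<beta> i} \<Longrightarrow> h i \<rho> = 0"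
    and sum: "(\<Sum>i=1..s. d i * e i) \<le> m - u"
    and j: "j \<in> {1..s}" "d j > 0" "\<not> int (b ^ e j) dvd h j (d j)"
  shows "(\<Sum>n\<in>{1..b ^ m}. row_char b e s \<beta> Z h n) = 0"
proof -
  define f where "f i a =
    (\<Prod>\<rho>=1..d i. additive_char (b ^ e i) (h i \<rho> * int (a div (b ^ e i) ^ (d i - \<rho>) mod b ^ e i)))" for i a
  have b: "b \<ge> 2" and x: "\<And>n. n \<in> {1..b ^ m} \<Longrightarrow> x n \<in> {1..s} \<rightarrow>\<^sub>E {0..<1}"
    using net by (auto simp: is_net_def)
  obtain y :: "nat \<Rightarrow> nat \<Rightarrow> nat \<Rightarrow> int" where
    y: "\<forall>n\<in>{1..b ^ m}. \<forall>i\<in>{1..s}.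
        (\<forall>l\<in>{1..m}. y n i l \<in> R b) \<and>
        x n i = (\<Sum>l=1..m. real_of_int (y n i l) / real b ^ l) \<and>
        (\<forall>\<rho>\<in>{1..\<beta> i}. real_of_int (Z n i \<rho>) =
           real b ^ (\<rho> * e i) *
             (\<Sum>l=(\<rho> - 1) * e i + 1..\<rho> * e i. real_of_int (y n i l) / real b ^ l))"
    using ooa unfolding ooa_from_points_def by blast
  have Z: "Z n i \<rho> = int (nat \<lfloor>real (b ^ e i) ^ d i * x n i\<rfloor> div (b ^ e i) ^ (d i - \<rho>) mod b ^ e i)"
    if "n \<in> {1..b ^ m}" "i \<in> {1..s}" "\<rho> \<in> {1..d i}" for n i \<rho>
  proof -
    have \<rho>: "\<rho> \<in> {1..\<beta> i}"
      using that(3) d[OF that(2)] by auto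
    have "\<rho> * e i \<le> \<beta> i * e i"
      using \<rho> by (intro mult_le_mono1) auto
    then have "\<rho> * e i \<le> m"
      using \<beta>[OF that(2)] by linarith
    then have "Z n i \<rho> = \<lfloor>real b ^ (\<rho> * e i) * x n i\<rfloor> mod int (b ^ e i)"
      using b y that \<rho> by (intro digit_block_eq_floor_mod[where y = "y n i" and m = m]) auto
    also have "real b ^ (\<rho> * e i) = real (b ^ e i) ^ \<rho>"
      by (simp add: power_mult[symmetric] mult.commute)
    also have "\<lfloor>real (b ^ e i) ^ \<rho> * x n i\<rfloor> =
        int (nat \<lfloor>real (b ^ e i) ^ d i * x n i\<rfloor> div (b ^ e i) ^ (d i - \<rho>))"
      using x[OF that(1)] that b by (intro floor_div_power) (auto simp: PiE_iff)
    finally show ?thesis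
      by (simp add: zmod_int)
  qed
  have "row_char b e s \<beta> Z h n = (\<Prod>i=1..s. f i (nat \<lfloor>real (b ^ e i) ^ d i * x n i\<rfloor>))"
    if n: "n \<in> {1..b ^ m}" for n
    unfolding row_char_def
  proof (intro prod.cong refl)
    fix i assume i: "i \<in> {1..s}"
    have "(\<Prod>\<rho>=1..\<beta> i. additive_char (b ^ e i) (h i \<rho> * Z n i \<rho>)) =
        (\<Prod>\<rho>=1..d i. additive_char (b ^ e i) (h i \<rho> * Z n i \<rho>))"
      using d[OF i] vanish[OF i] by (intro prod.mono_neutral_right) auto
    also have "\<dots> = f i (nat \<lfloor>real (b ^ e i) ^ d i * x n i\<rfloor>)"
      unfolding f_def using Z[OF n i] by (intro prod.cong) auto
    finally show "(\<Prod>\<rho>=1..\<beta> i. additive_char (b ^ e i) (h i \<rho> * Z n i \<rho>)) =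
        f i (nat \<lfloor>real (b ^ e i) ^ d i * x n i\<rfloor>)" .
  qed
  then have "(\<Sum>n\<in>{1..b ^ m}. row_char b e s \<beta> Z h n) =
      of_nat (b ^ (m - (\<Sum>i=1..s. d i * e i))) * (\<Prod>i=1..s. \<Sum>a<(b ^ e i) ^ d i. f i a)"
    using sum_net_prod[OF net sum, of f] by simp
  moreover have "(\<Sum>a<(b ^ e j) ^ d j. f j a) = 0"
    unfolding f_def using b j by (intro sum_digit_char_eq_0) auto
  ultimately show ?thesis
    using j(1) by (auto simp: prod_zero_iff)
qed

section \<open>Profiles of differences\<close>

lemma profile_le: "profile b m \<beta> Z D i \<le> \<beta> i"
proof (cases "\<forall>\<rho>\<in>{1..\<beta> i}. D i (col b m Z i \<rho>) = 0")
  case False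
  then have "Max {\<rho>\<in>{1..\<beta> i}. D i (col b m Z i \<rho>) \<noteq> 0} \<in> {\<rho>\<in>{1..\<beta> i}. D i (col b m Z i \<rho>) \<noteq> 0}"
    by (intro Max_in) auto
  then show ?thesis
    by (auto simp: profile_def)
qed (auto simp: profile_def)

lemma zero_beyond_profile:
  assumes "\<rho> \<in> {profile b m \<beta> Z D i<..\<beta> i}"
  shows "D i (col b m Z i \<rho>) = 0"
proof (rule ccontr)
  assume nz: "D i (col b m Z i \<rho>) \<noteq> 0"
  have \<rho>: "\<rho> \<in> {1..\<beta> i}"
    using assms by auto
  then have "\<rho> \<le> Max {\<rho>\<in>{1..\<beta> i}. D i (col b m Z i \<rho>) \<noteq> 0}"
    using nz by (intro Max_ge) auto
  also have "\<dots> = profile b m \<beta> Z D i"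
    using \<rho> nz unfolding profile_def by presburger
  finally show False
    using assms by simp
qed

lemma nonzero_at_profile:
  assumes "\<rho> \<in> {1..\<beta> i}" "D i (col b m Z i \<rho>) \<noteq> 0"
  shows "profile b m \<beta> Z D i > 0" "D i (col b m Z i (profile b m \<beta> Z D i)) \<noteq> 0"
proof -
  have "Max {\<rho>\<in>{1..\<beta> i}. D i (col b m Z i \<rho>) \<noteq> 0} \<in> {\<rho>\<in>{1..\<beta> i}. D i (col b m Z i \<rho>) \<noteq> 0}"
    using assms by (intro Max_in) auto
  then show "profile b m \<beta> Z D i > 0" "D i (col b m Z i (profile b m \<beta> Z D i)) \<noteq> 0"
    using assms by (auto simp: profile_def)
qed

lemma tuple_diff_col:
  assumes "i \<in> {1..s}" "\<rho> \<in> {1..\<beta> i}"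
  shows "tuple_diff b m e s \<beta> Z D D' i (col b m Z i \<rho>) =
    (D i (col b m Z i \<rho>) - D' i (col b m Z i \<rho>)) mod int (b ^ e i)"
proof -
  have "col b m Z i \<rho> \<in> cols b m \<beta> Z i"
    using assms(2) unfolding cols_def by (rule imageI)
  then show ?thesis
    using assms(1) by (simp add: tuple_diff_def)
qed

text \<open>
  Two residues in \<open>R (b ^ e i)\<close> that are congruent modulo \<open>b ^ e i\<close> are equal; hence reducing the
  difference of distinct tuples cannot make it zero everywhere.
\<close>

lemma tuple_diff_nonzero:
  assumes "D \<in> col_tuples b m e s \<beta> Z" "D' \<in> col_tuples b m e s \<beta> Z" "D \<noteq> D'"
  obtains i \<rho> where "i \<in> {1..s}" "\<rho> \<in> {1..\<beta> i}" "tuple_diff b m e s \<beta> Z D D' i (col b m Z i \<rho>) \<noteq> 0"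
proof -
  obtain i where i: "i \<in> {1..s}" "D i \<noteq> D' i"
    using PiE_ext[OF assms(1,2)[unfolded col_tuples_def]] assms(3) by blast
  have Di: "D i \<in> cols b m \<beta> Z i \<rightarrow>\<^sub>E R (b ^ e i)" "D' i \<in> cols b m \<beta> Z i \<rightarrow>\<^sub>E R (b ^ e i)"
    using assms i(1) unfolding col_tuples_def by (auto simp: PiE_iff)
  obtain z where z: "z \<in> cols b m \<beta> Z i" "D i z \<noteq> D' i z"
    using PiE_ext[OF Di] i(2) by blast
  then obtain \<rho> where \<rho>: "\<rho> \<in> {1..\<beta> i}" "z = col b m Z i \<rho>"
    by (auto simp: cols_def)
  have "D i z \<in> R (b ^ e i)" "D' i z \<in> R (b ^ e i)"
    using Di z(1) by (auto simp: PiE_iff)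
  then have "D i z mod int (b ^ e i) \<noteq> D' i z mod int (b ^ e i)"
    using z(2) by (simp add: R_def)
  then have "(D i z - D' i z) mod int (b ^ e i) \<noteq> 0"
    by (metis mod_eq_dvd_iff mod_0_imp_dvd)
  then show ?thesis
    using that[OF i(1) \<rho>(1)] tuple_diff_col[of i s \<rho> \<beta> b m e Z D D'] i(1) \<rho> by simp
qed

text \<open>
  The profile of the difference is used as the cut-off \<open>d\<close> of \<open>sum_row_char_eq_0\<close>: the difference
  vanishes beyond it, is a nonzero residue at it in some group, and the height is the number of
  leading digits that it selects.
\<close>

lemma row_chars_orthogonal:
  assumes net: "is_net b u m e s x" and ooa: "ooa_from_points b m e s \<beta> x Z"
    and \<beta>: "\<And>i. i \<in> {1..s} \<Longrightarrow> \<beta> i * e i \<le> m"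
    and D: "D \<in> col_tuples b m e s \<beta> Z" "D' \<in> col_tuples b m e s \<beta> Z" "D \<noteq> D'"
    and height: "height b m e s \<beta> Z (tuple_diff b m e s \<beta> Z D D') \<le> m - u"
  shows "(\<Sum>n\<in>{1..b ^ m}. row_char b e s \<beta> Z (\<lambda>i \<rho>. D i (col b m Z i \<rho>)) n
    * cnj (row_char b e s \<beta> Z (\<lambda>i \<rho>. D' i (col b m Z i \<rho>)) n)) = 0"
proof -
  define \<Delta> where "\<Delta> = tuple_diff b m e s \<beta> Z D D'"
  have b: "b > 0"
    using net by (auto simp: is_net_def)
  obtain j \<rho> where j: "j \<in> {1..s}" "\<rho> \<in> {1..\<beta> j}" "\<Delta> j (col b m Z j \<rho>) \<noteq> 0"
    using tuple_diff_nonzero[OF D] unfolding \<Delta>_def by blast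
  note top = nonzero_at_profile[where b = b and m = m and Z = Z and \<beta> = \<beta> and D = \<Delta> and i = j and \<rho> = \<rho>, OF j(2,3)]
  have "profile b m \<beta> Z \<Delta> j \<in> {1..\<beta> j}"
    using top(1) profile_le[of b m \<beta> Z \<Delta> j] by auto
  then have "\<Delta> j (col b m Z j (profile b m \<beta> Z \<Delta> j)) mod int (b ^ e j) =
      \<Delta> j (col b m Z j (profile b m \<beta> Z \<Delta> j))"
    using j(1) by (simp add: \<Delta>_def tuple_diff_col)
  then have ndvd: "\<not> int (b ^ e j) dvd \<Delta> j (col b m Z j (profile b m \<beta> Z \<Delta> j))"
    using top(2) by (metis dvd_imp_mod_0)
  have "(\<Sum>n\<in>{1..b ^ m}. row_char b e s \<beta> Z (\<lambda>i \<rho>. \<Delta> i (col b m Z i \<rho>)) n) = 0"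
  proof (rule sum_row_char_eq_0[where d = "profile b m \<beta> Z \<Delta>", OF net ooa])
    show "(\<Sum>i=1..s. profile b m \<beta> Z \<Delta> i * e i) \<le> m - u"
      using height by (simp add: height_def \<Delta>_def)
  qed (use \<beta> profile_le zero_beyond_profile j(1) top(1) ndvd in blast)+
  then show ?thesis
    using b by (subst row_char_diff[where h = "\<lambda>i \<rho>. \<Delta> i (col b m Z i \<rho>)"])
      (auto simp: \<Delta>_def tuple_diff_col)
qed

theorem theorem6:
  fixes b s u m :: nat
    and e \<beta> :: "nat \<Rightarrow> nat"
    and x :: "nat \<Rightarrow> nat \<Rightarrow> real"
    and Z :: "nat \<Rightarrow> nat \<Rightarrow> nat \<Rightarrow> int"
    and \<D> :: "(nat \<Rightarrow> column \<Rightarrow> int) set"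
  assumes "b \<ge> 2" and "s \<ge> 2"
    and "\<forall>i\<in>{1..s}. e i \<ge> 1"
    and "mono_on {1..s} e"
    and "m \<ge> u + e s"
    and "\<forall>i\<in>{1..s}. 1 \<le> \<beta> i \<and> \<beta> i \<le> (m - u) div e i"
    and "is_net b u m e s x"
    and "ooa_from_points b m e s \<beta> x Z"
    and "\<D> \<subseteq> col_tuples b m e s \<beta> Z"
    and "\<forall>D\<in>\<D>. \<forall>D'\<in>\<D>. height b m e s \<beta> Z (tuple_diff b m e s \<beta> Z D D') \<le> m - u"
  shows "b ^ m \<ge> card \<D>"
proof -
  have b: "b > 0"
    using assms(1) by simp
  have "\<beta> i * e i \<le> m" if "i \<in> {1..s}" for i
  proof -
    have "\<beta> i * e i \<le> (m - u) div e i * e i"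
      using assms(6) that by (intro mult_le_mono1) auto
    also have "\<dots> \<le> m"
      using div_times_less_eq_dividend[of "m - u" "e i"] by linarith
    finally show ?thesis .
  qed
  then have "card \<D> \<le> card {1..b ^ m}"
    using assms(7-10) b
    by (intro card_le_if_orthogonal_unimodular[where r = 1
          and \<phi> = "\<lambda>D. row_char b e s \<beta> Z (\<lambda>i \<rho>. D i (col b m Z i \<rho>))"]
        row_chars_orthogonal[where u = u and x = x]) auto
  then show ?thesis
    by simp
qed

end
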